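(* Let $K\subset\mathbb{C}$ be a field that is finitely generated over $\mathbb{Q}$, let $n\in\mathbb{N}$, and let $a_1,\ldots,a_{n+1}\in\mathbb{C}$ be constants, not all zero. Let $V$ be the set of (restrictions to $K^{*}$ of) additive functions $A\colon K\to\mathbb{C}$ satisfying $$\sum_{i=0}^{n}(n+1-i)\,a_{n+1-i}\left(x^{i}A\left(c\,x^{n+1-i}\right)-x^{i+1}A\left(c\,x^{n-i}\right)\right)=0\qquad\text{for all } x\in K,\ c\in K^{*}.$$ Then $V$ contains every additive function $A\colon K\to\mathbb{C}$ satisfying $$\sum_{i=0}^{n}a_{n+1-i}\,x^{i}A\left(x^{n+1-i}\right)=0\qquad\text{for all } x\in K;$$ $V$ is a variety on $K^{*}$; every exponential $m\in V$ is the identity, i.e. $m(x)=x$ for all $x\in K^{*}$; and $V$ is spanned by differential operators on $K$.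
   Context: $K^{*}$ is the multiplicative group of $K$. The space $\mathbb{C}^{K^{*}}$ of complex valued functions on $K^{*}$ carries the product topology (pointwise convergence). A variety on $K^{*}$ is a closed linear subspace $V\subset\mathbb{C}^{K^{*}}$ which is translation invariant: for every $f\in V$ and $c\in K^{*}$, the function $x\mapsto f(cx)$ belongs to $V$. An additive function $A\colon K\to\mathbb{C}$ satisfies $A(x+y)=A(x)+A(y)$ for all $x,y\in K$, and is identified with its restriction to $K^{*}$. An exponential is a nonzero function $m\colon K^{*}\to\mathbb{C}$ with $m(xy)=m(x)m(y)$ for all $x,y\in K^{*}$. A differential operator on $K$ is a complex linear combination of finitely many mappings of the form $d_1\circ\cdots\circ d_k$, where $d_1,\ldots,d_k$ are derivations on $K$ (additive maps satisfying $d(xy)=d(x)y+xd(y)$); for $k=0$ the composition is by convention the identity function. "$V$ is spanned by differential operators" means that $V$ is the smallest closed linear subspace containing the differential operators that belong to $V$, i.e. their linear span is dense in $V$. Convention: $x^0=1$ for all $x\in K$. *)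

theory Defs
  imports "HOL-Analysis.Analysis"
begin

definition is_subfield :: "complex set \<Rightarrow> bool" where
  "is_subfield K \<longleftrightarrow> 0 \<in> K \<and> 1 \<in> K \<and>
     (\<forall>x\<in>K. \<forall>y\<in>K. x + y \<in> K \<and> x * y \<in> K) \<and>
     (\<forall>x\<in>K. - x \<in> K \<and> inverse x \<in> K)"

(* Every subfield of the complex numbers contains the rationals, so the field generated
   by S over the rationals is the least subfield containing S. *)
definition fin_gen_over_rat :: "complex set \<Rightarrow> bool" where
  "fin_gen_over_rat K \<longleftrightarrow> (\<exists>S. finite S \<and> K = is_subfield hull S)"

abbreviation units_of_field :: "complex set \<Rightarrow> complex set" where
  "units_of_field K \<equiv> K - {0}"

(* The space of complex functions on X is carried by the extensional functions
   X \<rightarrow>\<^sub>E UNIV, which is the topspace of the product topology below. *)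
abbreviation pointwise_topology :: "'a set \<Rightarrow> ('a \<Rightarrow> complex) topology" where
  "pointwise_topology X \<equiv> product_topology (\<lambda>_. euclidean) X"

definition linear_subspace :: "'a set \<Rightarrow> ('a \<Rightarrow> complex) set \<Rightarrow> bool" where
  "linear_subspace X W \<longleftrightarrow> W \<subseteq> (X \<rightarrow>\<^sub>E UNIV) \<and> (\<lambda>x\<in>X. 0) \<in> W \<and>
     (\<forall>f\<in>W. \<forall>g\<in>W. (\<lambda>x\<in>X. f x + g x) \<in> W) \<and>
     (\<forall>b. \<forall>f\<in>W. (\<lambda>x\<in>X. b * f x) \<in> W)"

definition closed_linear_subspace :: "'a set \<Rightarrow> ('a \<Rightarrow> complex) set \<Rightarrow> bool" where
  "closed_linear_subspace X W \<longleftrightarrow>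
     linear_subspace X W \<and> closedin (pointwise_topology X) W"

definition variety :: "complex set \<Rightarrow> (complex \<Rightarrow> complex) set \<Rightarrow> bool" where
  "variety K V \<longleftrightarrow> closed_linear_subspace (units_of_field K) V \<and>
     (\<forall>f\<in>V. \<forall>c\<in>units_of_field K. (\<lambda>x\<in>units_of_field K. f (c * x)) \<in> V)"

definition additive_on :: "complex set \<Rightarrow> (complex \<Rightarrow> complex) \<Rightarrow> bool" where
  "additive_on K A \<longleftrightarrow> (\<forall>x\<in>K. \<forall>y\<in>K. A (x + y) = A x + A y)"

definition exponential :: "complex set \<Rightarrow> (complex \<Rightarrow> complex) \<Rightarrow> bool" where
  "exponential K m \<longleftrightarrow> m \<in> (units_of_field K \<rightarrow>\<^sub>E UNIV) \<and>
     (\<exists>x\<in>units_of_field K. m x \<noteq> 0) \<and>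
     (\<forall>x\<in>units_of_field K. \<forall>y\<in>units_of_field K. m (x * y) = m x * m y)"

(* Derivations map K to itself, so that they can be composed; values outside K are irrelevant. *)
definition derivation_on :: "complex set \<Rightarrow> (complex \<Rightarrow> complex) \<Rightarrow> bool" where
  "derivation_on K d \<longleftrightarrow> d ` K \<subseteq> K \<and> additive_on K d \<and>
     (\<forall>x\<in>K. \<forall>y\<in>K. d (x * y) = d x * y + x * d y)"

definition differential_operator :: "complex set \<Rightarrow> (complex \<Rightarrow> complex) \<Rightarrow> bool" where
  "differential_operator K D \<longleftrightarrow>
     (\<exists>(N::nat) (b :: nat \<Rightarrow> complex) (ds :: nat \<Rightarrow> (complex \<Rightarrow> complex) list).
        (\<forall>j<N. \<forall>d\<in>set (ds j). derivation_on K d) \<and>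
        (\<forall>x\<in>K. D x = (\<Sum>j<N. b j * foldr (\<circ>) (ds j) id x)))"

definition spanned_by_differential_operators ::
    "complex set \<Rightarrow> (complex \<Rightarrow> complex) set \<Rightarrow> bool" where
  "spanned_by_differential_operators K V \<longleftrightarrow>
     V = closed_linear_subspace (units_of_field K) hull
           {f \<in> V. \<exists>D. differential_operator K D \<and> f = restrict D (units_of_field K)}"

end

theory Submission
  imports Defs "HOL-Computational_Algebra.Polynomial"
begin

text \<open>Write \<open>ad x A\<close> for the function \<open>y \<mapsto> A (x y) - x A y\<close>. The equation defining \<open>V\<close>, read at
  \<open>x + r\<close> for all natural numbers \<open>r\<close>, is a polynomial identity in \<open>r\<close>, and its coefficients give
  \<open>(ad x)^N A = 0\<close> for all \<open>x\<close>, where \<open>N\<close> is the largest index with \<open>a N \<noteq> 0\<close>. After polarization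
  all products of \<open>N\<close> commutators \<open>ad x\<close> kill \<open>A\<close>, so \<open>A\<close> is a differential operator in the sense
  of Grothendieck. As \<open>K\<close> is finitely generated, it has derivations \<open>d t\<close> dual to finitely many
  elements \<open>t\<close>, and by Euler's identity for the symbol an operator \<open>A\<close> of order \<open>k\<close> agrees with
  \<open>1/k\<close> times the sum of the \<open>ad t A \<circ> d t\<close> up to lower order. Hence every element of \<open>V\<close> is itself
  a differential operator, and no limits are needed.\<close>

section \<open>Derivations of finitely generated fields\<close>

locale complex_subfield =
  fixes K :: "complex set"
  assumes subfield: "is_subfield K"
begin

lemma zero_mem [simp]: "0 \<in> K" and one_mem [simp]: "1 \<in> K"
  using subfield by (auto simp: is_subfield_def)

lemma add_mem: "x \<in> K \<Longrightarrow> y \<in> K \<Longrightarrow> x + y \<in> K"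
  and mult_mem: "x \<in> K \<Longrightarrow> y \<in> K \<Longrightarrow> x * y \<in> K"
  and uminus_mem: "x \<in> K \<Longrightarrow> - x \<in> K"
  and inverse_mem: "x \<in> K \<Longrightarrow> inverse x \<in> K"
  using subfield by (auto simp: is_subfield_def)

lemma diff_mem: "x \<in> K \<Longrightarrow> y \<in> K \<Longrightarrow> x - y \<in> K"
  using add_mem[of x "- y"] uminus_mem by simp

lemma power_mem: "x \<in> K \<Longrightarrow> x ^ k \<in> K"
  by (induction k) (auto intro: mult_mem)

lemma of_nat_mem [simp]: "of_nat k \<in> K"
  by (induction k) (auto intro: add_mem)

lemmas mem_intros = add_mem mult_mem uminus_mem inverse_mem diff_mem power_mem

lemma additive_zero: "additive_on K A \<Longrightarrow> A 0 = 0"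
  unfolding additive_on_def by (metis add.right_neutral add_cancel_right_right zero_mem)

lemma additive_uminus:
  assumes "additive_on K A" "x \<in> K"
  shows "A (- x) = - A x"
proof -
  have "A (x + - x) = A x + A (- x)"
    using assms uminus_mem by (simp only: additive_on_def)
  then show ?thesis
    using additive_zero[OF assms(1)] by (simp add: eq_neg_iff_add_eq_0 add.commute)
qed

lemma additive_of_nat_mult:
  assumes "additive_on K A" "x \<in> K"
  shows "A (of_nat r * x) = of_nat r * A x"
proof (induction r)
  case 0
  then show ?case by (simp add: additive_zero[OF assms(1)])
next
  case (Suc r)
  have "A (of_nat r * x + x) = A (of_nat r * x) + A x"
    using assms by (simp add: additive_on_def mult_mem)
  then show ?case using Suc by (simp add: algebra_simps)
qed

text \<open>By Zorn, take a \<open>K\<close>-subspace \<open>M\<close> of the complex numbers maximal with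
  \<open>1 \<notin> M\<close>; then \<open>K\<close> and \<open>M\<close> are complementary.\<close>
lemma ex_linear_projection:
  "\<exists>l. range l \<subseteq> K \<and> l 1 = 1 \<and> (\<forall>z w. l (z + w) = l z + l w) \<and>
     (\<forall>k\<in>K. \<forall>z. l (k * z) = k * l z)"
proof -
  define \<M> where "\<M> = {M. 1 \<notin> M \<and> (\<forall>z\<in>M. \<forall>w\<in>M. z + w \<in> M) \<and> (\<forall>k\<in>K. \<forall>z\<in>M. k * z \<in> M)}"
  have "\<exists>M\<in>\<M>. \<forall>X\<in>\<M>. M \<subseteq> X \<longrightarrow> X = M"
  proof (rule subset_Zorn')
    fix C assume C: "subset.chain \<M> C"
    then have sub: "C \<subseteq> \<M>" and tot: "\<And>X Y. X \<in> C \<Longrightarrow> Y \<in> C \<Longrightarrow> X \<subseteq> Y \<or> Y \<subseteq> X"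
      by (auto simp: subset_chain_def)
    have "z + w \<in> \<Union> C" if zw: "z \<in> \<Union> C" "w \<in> \<Union> C" for z w
    proof -
      obtain X Y where XY: "X \<in> C" "z \<in> X" "Y \<in> C" "w \<in> Y" using zw by blast
      then obtain Z where "Z \<in> C" "z \<in> Z" "w \<in> Z" using tot[of X Y] by blast
      then show ?thesis using sub unfolding \<M>_def by blast
    qed
    moreover have "k * z \<in> \<Union> C" if "k \<in> K" "z \<in> \<Union> C" for k z
      using that sub unfolding \<M>_def by blast
    moreover have "1 \<notin> \<Union> C" using sub unfolding \<M>_def by blast
    ultimately show "\<Union> C \<in> \<M>" unfolding \<M>_def by blast
  qed
  then obtain M where M: "M \<in> \<M>" and max: "\<And>X. X \<in> \<M> \<Longrightarrow> M \<subseteq> X \<Longrightarrow> X = M" by blast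
  have one: "1 \<notin> M" and add: "\<And>z w. z \<in> M \<Longrightarrow> w \<in> M \<Longrightarrow> z + w \<in> M"
    and scale: "\<And>k z. k \<in> K \<Longrightarrow> z \<in> M \<Longrightarrow> k * z \<in> M"
    using M unfolding \<M>_def by auto
  have zero: "0 \<in> M"
  proof -
    \<comment> \<open>Members of \<open>\<M>\<close> may be empty, which serves the empty chain in
      Zorn's lemma; 0 is therefore recovered from maximality.\<close>
    have "insert 0 M \<in> \<M>" using M unfolding \<M>_def by auto
    then show ?thesis using max[of "insert 0 M"] by blast
  qed
  have minus: "z - w \<in> M" if "z \<in> M" "w \<in> M" for z w
    using add[OF that(1) scale[OF _ that(2), of "- 1"]] uminus_mem[of 1] by simp
  have ex: "\<exists>k\<in>K. z - k \<in> M" for z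
  proof (cases "z \<in> M")
    case True
    then show ?thesis by (intro bexI[of _ 0]) auto
  next
    case False
    \<comment> \<open>\<open>X\<close> is the span of \<open>M\<close> and \<open>z\<close>. By
      maximality it must contain 1, and \<open>1 = m + k * z\<close> can be solved for
      \<open>z\<close> modulo \<open>M\<close>.\<close>
    define X where "X = {m + k * z | m k. m \<in> M \<and> k \<in> K}"
    have "M \<subseteq> X"
    proof
      fix m assume "m \<in> M"
      then have "m = m + 0 * z" "m \<in> M" by auto
      then show "m \<in> X" unfolding X_def using zero_mem by blast
    qed
    have zX: "z \<in> X"
    proof -
      have "z = 0 + 1 * z" by simp
      then show ?thesis unfolding X_def using zero one_mem by blast
    qed
    have "X \<notin> \<M>" using max[OF _ \<open>M \<subseteq> X\<close>] zX False by blast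
    moreover have "x + y \<in> X" if xy: "x \<in> X" "y \<in> X" for x y
    proof -
      obtain m k m' k' where "x = m + k * z" "y = m' + k' * z" "m \<in> M" "m' \<in> M" "k \<in> K" "k' \<in> K"
        using xy unfolding X_def by blast
      then have "x + y = (m + m') + (k + k') * z" "m + m' \<in> M" "k + k' \<in> K"
        by (auto simp: algebra_simps intro: add add_mem)
      then show ?thesis unfolding X_def by blast
    qed
    moreover have "c * x \<in> X" if cx: "c \<in> K" "x \<in> X" for c x
    proof -
      obtain m k where "x = m + k * z" "m \<in> M" "k \<in> K" using cx unfolding X_def by blast
      then have "c * x = c * m + (c * k) * z" "c * m \<in> M" "c * k \<in> K"
        using cx by (auto simp: algebra_simps intro: scale mult_mem)
      then show ?thesis unfolding X_def by blast
    qed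
    ultimately have "1 \<in> X" unfolding \<M>_def by blast
    then obtain m k where mk: "1 = m + k * z" "m \<in> M" "k \<in> K" unfolding X_def by blast
    have "k \<noteq> 0" using mk one by auto
    have "k * z = 1 - m" using mk(1) by (metis add_diff_cancel_left')
    then have "z = inverse k * (1 - m)"
      using \<open>k \<noteq> 0\<close> by (metis left_inverse mult.assoc mult_1)
    then have "z - inverse k = - inverse k * m"
      by (simp add: algebra_simps)
    moreover have "- inverse k * m \<in> M"
      using mk by (intro scale mem_intros)
    ultimately show ?thesis using mk inverse_mem by metis
  qed
  \<comment> \<open>A nonzero element of \<open>K\<close> lying in \<open>M\<close> could be
    rescaled to 1.\<close>
  have uniq: "k = k'" if "k \<in> K" "k' \<in> K" "z - k \<in> M" "z - k' \<in> M" for z k k'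
  proof (rule ccontr)
    assume "k \<noteq> k'"
    have "k' - k \<in> M" using minus[OF that(3,4)] by simp
    then have "inverse (k' - k) * (k' - k) \<in> M"
      using that by (intro scale mem_intros)
    then show False using one \<open>k \<noteq> k'\<close> by simp
  qed
  define l where "l z = (SOME k. k \<in> K \<and> z - k \<in> M)" for z
  have l: "l z \<in> K" "z - l z \<in> M" for z
    using someI_ex[of "\<lambda>k. k \<in> K \<and> z - k \<in> M"] ex[of z] unfolding l_def by blast+
  have "l 1 = 1" using uniq[of "l 1" 1 1] l zero by simp
  moreover have "l (z + w) = l z + l w" for z w
    using uniq[of "l (z + w)" "l z + l w" "z + w"] l add_mem add[OF l(2)[of z] l(2)[of w]]
    by (simp add: algebra_simps)
  moreover have "l (k * z) = k * l z" if "k \<in> K" for k z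
    using uniq[of "l (k * z)" "k * l z" "k * z"] l that mult_mem scale[OF that l(2)[of z]]
    by (simp add: algebra_simps)
  ultimately show ?thesis using l by blast
qed

text \<open>Unlike in \<open>derivation_on\<close>, values may leave \<open>K\<close>: derivations
  read off from commutators of complex-valued functions are of this kind.\<close>

definition complex_derivation :: "(complex \<Rightarrow> complex) \<Rightarrow> bool" where
  "complex_derivation D \<longleftrightarrow>
     additive_on K D \<and> (\<forall>x\<in>K. \<forall>y\<in>K. D (x * y) = D x * y + x * D y)"

text \<open>The zeros of a derivation form a subfield of \<open>K\<close>, so killing the generators
  means killing the field.\<close>

lemma complex_derivation_eq_zero:
  assumes D: "complex_derivation D" and K: "K = is_subfield hull S"
    and S: "\<And>s. s \<in> S \<Longrightarrow> D s = 0" and x: "x \<in> K"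
  shows "D x = 0"
proof -
  have add: "additive_on K D" and Leibniz: "\<And>x y. x \<in> K \<Longrightarrow> y \<in> K \<Longrightarrow> D (x * y) = D x * y + x * D y"
    using D by (auto simp: complex_derivation_def)
  have D0: "D 0 = 0" by (rule additive_zero[OF add])
  have D1: "D 1 = 0" using Leibniz[of 1 1] by simp
  have "D (inverse y) = 0" if "y \<in> K" "D y = 0" for y
  proof (cases "y = 0")
    case False
    then show ?thesis using Leibniz[of y "inverse y"] that D1 inverse_mem by simp
  qed (simp add: D0)
  then have "is_subfield {y \<in> K. D y = 0}"
    using D0 D1 add additive_uminus[OF add] Leibniz
    by (auto simp: is_subfield_def additive_on_def intro: mem_intros)
  moreover have "S \<subseteq> {y \<in> K. D y = 0}" using S K hull_subset[of S is_subfield] by auto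
  ultimately show ?thesis using hull_minimal[of S _ is_subfield] K x by blast
qed

lemma derivation_on_imp_complex_derivation: "derivation_on K d \<Longrightarrow> complex_derivation d"
  by (simp add: derivation_on_def complex_derivation_def)

text \<open>A minimal subset \<open>T\<close> of the generators on which derivations are determined; minimality
  yields, for each \<open>t \<in> T\<close>, a complex derivation vanishing on \<open>T - {t}\<close> only, and a
  projection onto \<open>K\<close> makes it \<open>K\<close>-valued.\<close>
lemma ex_dual_derivations:
  assumes "fin_gen_over_rat K"
  shows "\<exists>T d. finite T \<and> T \<subseteq> K \<and> (\<forall>t\<in>T. derivation_on K (d t)) \<and>
    (\<forall>D. complex_derivation D \<longrightarrow> (\<forall>x\<in>K. D x = (\<Sum>t\<in>T. d t x * D t)))"
proof -
  obtain S where S: "finite S" "K = is_subfield hull S"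
    using assms by (auto simp: fin_gen_over_rat_def)
  define determining where "determining T \<longleftrightarrow> T \<subseteq> S \<and>
    (\<forall>D. complex_derivation D \<and> (\<forall>t\<in>T. D t = 0) \<longrightarrow> (\<forall>x\<in>K. D x = 0))" for T
  have "determining S"
    using complex_derivation_eq_zero[OF _ S(2)] unfolding determining_def by blast
  then obtain T where T: "determining T" and min: "\<And>T'. determining T' \<Longrightarrow> card T \<le> card T'"
    using ex_has_least_nat[of determining S card] by blast
  have TS: "T \<subseteq> S" and fin: "finite T" and TK: "T \<subseteq> K"
    using T S hull_subset[of S is_subfield] finite_subset by (auto simp: determining_def)
  obtain l where l: "range l \<subseteq> K" "l 1 = 1" "\<And>z w. l (z + w) = l z + l w"
    "\<And>k z. k \<in> K \<Longrightarrow> l (k * z) = k * l z"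
    using ex_linear_projection by metis
  have l0: "l 0 = 0" using l(4)[of 0 0] by simp
  have "\<exists>d. derivation_on K d \<and> (\<forall>s\<in>T. d s = (if s = t then 1 else 0))" if t: "t \<in> T" for t
  proof -
    have "\<not> determining (T - {t})"
      using min[of "T - {t}"] card_Diff1_less[OF fin t] by auto
    then obtain D x where D: "complex_derivation D" "\<forall>s\<in>T - {t}. D s = 0" "x \<in> K" "D x \<noteq> 0"
      using TS unfolding determining_def by blast
    have Dt: "D t \<noteq> 0" using T D unfolding determining_def by blast
    \<comment> \<open>Division by \<open>D t\<close> normalizes the value at \<open>t\<close>, and
      \<open>l 1 = 1\<close> preserves it. The Leibniz rule survives because \<open>l\<close> is
      \<open>K\<close>-linear.\<close>
    define d where "d x = l (D x / D t)" for x
    have "derivation_on K d"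
    proof -
      have "d (x * y) = d x * y + x * d y" if "x \<in> K" "y \<in> K" for x y
      proof -
        have "D (x * y) / D t = y * (D x / D t) + x * (D y / D t)"
          using D(1) that by (simp add: complex_derivation_def add_divide_distrib)
        then have "d (x * y) = l (y * (D x / D t) + x * (D y / D t))"
          unfolding d_def by (rule arg_cong)
        then show ?thesis using that by (simp only: l d_def mult.commute)
      qed
      then show ?thesis
        using D(1) l unfolding derivation_on_def complex_derivation_def additive_on_def d_def
        by (auto simp: add_divide_distrib)
    qed
    moreover have "\<forall>s\<in>T. d s = (if s = t then 1 else 0)"
      using D(2) Dt l0 l(2) by (auto simp: d_def)
    ultimately show ?thesis by blast
  qed
  then obtain d where d: "\<And>t. t \<in> T \<Longrightarrow> derivation_on K (d t)"
    "\<And>s t. s \<in> T \<Longrightarrow> t \<in> T \<Longrightarrow> d t s = (if s = t then 1 else 0)" by metis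
  have "D x = (\<Sum>t\<in>T. d t x * D t)" if D: "complex_derivation D" and x: "x \<in> K" for D x
  proof -
    \<comment> \<open>By duality \<open>E\<close> vanishes on \<open>T\<close>, hence on
      \<open>K\<close>, as \<open>T\<close> is determining.\<close>
    define E where "E x = D x - (\<Sum>t\<in>T. d t x * D t)" for x
    have "complex_derivation E"
      using D d(1)[THEN derivation_on_imp_complex_derivation]
      by (simp add: complex_derivation_def additive_on_def E_def sum.distrib
          sum_distrib_left sum_distrib_right algebra_simps)
    moreover have "E s = 0" if "s \<in> T" for s
      using that d(2)[OF that] fin
      by (simp add: E_def if_distrib[of "\<lambda>z. z * _"] sum.delta cong: sum.cong if_cong)
    ultimately have "E x = 0" using T x unfolding determining_def by blast
    then show ?thesis by (simp add: E_def)
  qed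
  then show ?thesis using fin TK d(1) by (intro exI[of _ T] exI[of _ d] conjI allI impI ballI)
qed


end

section \<open>Differential operators\<close>

lemma differential_operator_cong:
  "differential_operator K D \<Longrightarrow> (\<And>x. x \<in> K \<Longrightarrow> D' x = D x) \<Longrightarrow> differential_operator K D'"
  unfolding differential_operator_def by simp

lemma differential_operator_zero: "differential_operator K (\<lambda>x. 0)"
  unfolding differential_operator_def by (rule exI[of _ 0]) auto

lemma differential_operator_id: "differential_operator K (\<lambda>x. x)"
  unfolding differential_operator_def
  by (intro exI[of _ 1] exI[of _ "\<lambda>_. 1"] exI[of _ "\<lambda>_. []"]) auto

lemma differential_operator_scale:
  assumes "differential_operator K D"
  shows "differential_operator K (\<lambda>x. c * D x)"
proof -
  obtain N :: nat and b ds where "\<forall>j<N. \<forall>d\<in>set (ds j). derivation_on K d"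
    "\<forall>x\<in>K. D x = (\<Sum>j<N. b j * foldr (\<circ>) (ds j) id x)"
    using assms unfolding differential_operator_def by blast
  then show ?thesis unfolding differential_operator_def
    by (intro exI[of _ N] exI[of _ "\<lambda>j. c * b j"] exI[of _ ds]) (simp add: sum_distrib_left mult.assoc)
qed

lemma differential_operator_add:
  assumes "differential_operator K D" "differential_operator K D'"
  shows "differential_operator K (\<lambda>x. D x + D' x)"
proof -
  obtain N :: nat and b ds where 1: "\<forall>j<N. \<forall>d\<in>set (ds j). derivation_on K d"
    "\<forall>x\<in>K. D x = (\<Sum>j<N. b j * foldr (\<circ>) (ds j) id x)"
    using assms(1) unfolding differential_operator_def by blast
  obtain N' :: nat and b' ds' where 2: "\<forall>j<N'. \<forall>d\<in>set (ds' j). derivation_on K d"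
    "\<forall>x\<in>K. D' x = (\<Sum>j<N'. b' j * foldr (\<circ>) (ds' j) id x)"
    using assms(2) unfolding differential_operator_def by blast
  define B where "B j = (if j < N then b j else b' (j - N))" for j
  define Ds where "Ds j = (if j < N then ds j else ds' (j - N))" for j
  have split: "(\<Sum>j<N + M. g j) = (\<Sum>j<N. g j) + (\<Sum>j<M. g (N + j))" for g :: "nat \<Rightarrow> complex" and M
    by (induction M) (simp_all add: add.assoc)
  have "(\<Sum>j<N + N'. B j * foldr (\<circ>) (Ds j) id x) =
      (\<Sum>j<N. b j * foldr (\<circ>) (ds j) id x) + (\<Sum>j<N'. b' j * foldr (\<circ>) (ds' j) id x)" for x
    unfolding split by (simp add: B_def Ds_def)
  moreover have "\<forall>j<N + N'. \<forall>d\<in>set (Ds j). derivation_on K d"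
  proof (intro allI impI)
    fix j assume "j < N + N'"
    then show "\<forall>d\<in>set (Ds j). derivation_on K d"
      using 1(1) 2(1)[rule_format, of "j - N"] by (cases "j < N") (auto simp: Ds_def)
  qed
  ultimately show ?thesis using 1(2) 2(2) unfolding differential_operator_def
    by (intro exI[of _ "N + N'"] exI[of _ B] exI[of _ Ds]) simp
qed

lemma differential_operator_sum:
  "(\<And>t. t \<in> T \<Longrightarrow> differential_operator K (D t)) \<Longrightarrow> differential_operator K (\<lambda>x. \<Sum>t\<in>T. D t x)"
  by (induction T rule: infinite_finite_induct)
    (auto intro: differential_operator_zero differential_operator_add)

text \<open>The derivation stands on the inside because \<open>D\<close> may take values outside
  \<open>K\<close>; it is appended at the end of each list, which acts first.\<close>

lemma differential_operator_comp_derivation: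
  assumes "differential_operator K D" "derivation_on K d"
  shows "differential_operator K (\<lambda>x. D (d x))"
proof -
  obtain N :: nat and b ds where D: "\<forall>j<N. \<forall>d\<in>set (ds j). derivation_on K d"
    "\<forall>x\<in>K. D x = (\<Sum>j<N. b j * foldr (\<circ>) (ds j) id x)"
    using assms(1) unfolding differential_operator_def by blast
  have "d x \<in> K" if "x \<in> K" for x
    using assms(2) that by (auto simp: derivation_on_def)
  moreover have "foldr (\<circ>) (es @ [d]) id x = foldr (\<circ>) es id (d x)" for es :: "(complex \<Rightarrow> complex) list" and x
    by (induction es) auto
  ultimately show ?thesis using D assms(2) unfolding differential_operator_def
    by (intro exI[of _ N] exI[of _ b] exI[of _ "\<lambda>j. ds j @ [d]"]) auto
qed

text \<open>Both the translation by \<open>x\<close> (\<open>u = x\<close>, \<open>p = 0\<close>) and the commutator with the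
  multiplication by \<open>x\<close> (\<open>u = x\<close>, \<open>p = - x\<close>) are of this form.\<close>
definition twist :: "complex \<Rightarrow> complex \<Rightarrow> (complex \<Rightarrow> complex) \<Rightarrow> complex \<Rightarrow> complex" where
  "twist u p f = (\<lambda>c. f (u * c) + p * f c)"

abbreviation ad :: "complex \<Rightarrow> (complex \<Rightarrow> complex) \<Rightarrow> complex \<Rightarrow> complex" where
  "ad x \<equiv> twist x (- x)"

text \<open>Multiplications of the argument and of the value all commute, so iterated commutators
  may be reordered.\<close>

lemma twist_commute: "twist u p (twist v q f) = twist v q (twist u p f)"
  by (rule ext) (simp add: twist_def algebra_simps)

lemma funpow_twist_commute: "(twist u p ^^ m) (twist v q f) = twist v q ((twist u p ^^ m) f)"
  by (induction m) (simp_all add: twist_commute)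

lemma funpow_translation: "(twist u 0 ^^ m) f c = f (u ^ m * c)"
  by (induction m arbitrary: c) (simp_all add: twist_def mult_ac)

text \<open>The Grothendieck differential operators from \<open>K\<close> to the complex numbers of order less
  than the second argument.\<close>
primrec order_less :: "complex set \<Rightarrow> nat \<Rightarrow> (complex \<Rightarrow> complex) \<Rightarrow> bool" where
  "order_less K 0 A \<longleftrightarrow> (\<forall>y\<in>K. A y = 0)"
| "order_less K (Suc k) A \<longleftrightarrow> additive_on K A \<and> (\<forall>x\<in>K. order_less K k (ad x A))"

section \<open>Grothendieck operators are differential operators\<close>

context complex_subfield
begin

lemma additive_on_twist: "additive_on K A \<Longrightarrow> u \<in> K \<Longrightarrow> additive_on K (twist u p A)"
  by (simp add: additive_on_def twist_def algebra_simps mult_mem)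

lemma additive_on_funpow_twist:
  "additive_on K A \<Longrightarrow> u \<in> K \<Longrightarrow> additive_on K ((twist u p ^^ m) A)"
  by (induction m) (simp_all add: additive_on_twist)

lemma order_less_additive: "order_less K k A \<Longrightarrow> additive_on K A"
  by (cases k) (simp_all add: additive_on_def add_mem)

lemma order_less_ad: "order_less K (Suc k) A \<Longrightarrow> x \<in> K \<Longrightarrow> order_less K k (ad x A)"
  by simp

lemma order_less_cong:
  "order_less K k A \<Longrightarrow> (\<And>y. y \<in> K \<Longrightarrow> B y = A y) \<Longrightarrow> order_less K k B"
proof (induction k arbitrary: A B)
  case (Suc k)
  have "order_less K k (ad x B)" if "x \<in> K" for x
    using Suc.prems(2) that
    by (intro Suc.IH[OF order_less_ad[OF Suc.prems(1) that]]) (simp add: twist_def mult_mem)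
  then show ?case using Suc.prems by (simp add: additive_on_def add_mem)
qed simp

lemma order_less_add:
  "order_less K k A \<Longrightarrow> order_less K k B \<Longrightarrow> order_less K k (\<lambda>y. A y + B y)"
proof (induction k arbitrary: A B)
  case (Suc k)
  have "order_less K k (ad x (\<lambda>y. A y + B y))" if "x \<in> K" for x
    by (rule order_less_cong[OF Suc.IH[OF order_less_ad[OF Suc.prems(1) that] order_less_ad[OF Suc.prems(2) that]]])
      (simp add: twist_def algebra_simps)
  then show ?case using Suc.prems by (simp add: additive_on_def)
qed simp

lemma order_less_scale: "order_less K k A \<Longrightarrow> order_less K k (\<lambda>y. c * A y)"
proof (induction k arbitrary: A)
  case (Suc k)
  have "order_less K k (ad x (\<lambda>y. c * A y))" if "x \<in> K" for x
    by (rule order_less_cong[OF Suc.IH[OF order_less_ad[OF Suc.prems that]]])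
      (simp add: twist_def algebra_simps)
  then show ?case using Suc.prems by (simp add: additive_on_def algebra_simps)
qed simp

lemma order_less_zero: "order_less K k (\<lambda>y. 0)"
  by (induction k) (simp_all add: additive_on_def twist_def)

lemma order_less_diff:
  "order_less K k A \<Longrightarrow> order_less K k B \<Longrightarrow> order_less K k (\<lambda>y. A y - B y)"
  using order_less_add[of k A "\<lambda>y. - 1 * B y"] order_less_scale[of k B "- 1"] by simp

lemma order_less_sum:
  "(\<And>t. t \<in> T \<Longrightarrow> order_less K k (A t)) \<Longrightarrow> order_less K k (\<lambda>y. \<Sum>t\<in>T. A t y)"
  by (induction T rule: infinite_finite_induct) (auto intro: order_less_zero order_less_add)

lemma additive_on_comp_derivation:
  assumes "order_less K k A" "derivation_on K d"
  shows "additive_on K (\<lambda>y. A (d y))"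
  using order_less_additive[OF assms(1)] assms(2)
  by (auto simp: additive_on_def derivation_on_def)

text \<open>Modulo lower order, \<open>ad x A\<close> depends on \<open>x\<close> as a derivation
  and so expands in the dual derivations. For \<open>k = 0\<close> this is the duality itself;
  larger \<open>k\<close> reduce to smaller ones by a further commutator.\<close>

lemma order_less_ad_expansion:
  assumes dual: "\<And>D x. complex_derivation D \<Longrightarrow> x \<in> K \<Longrightarrow> D x = (\<Sum>t\<in>T. d t x * D t)"
    and T: "T \<subseteq> K" and A: "order_less K (Suc (Suc k)) A" and x: "x \<in> K"
  shows "order_less K k (\<lambda>y. ad x A y - (\<Sum>t\<in>T. d t x * ad t A y))"
  using A
proof (induction k arbitrary: A)
  case 0
  have add: "additive_on K A" and zero: "\<And>x y z. x \<in> K \<Longrightarrow> y \<in> K \<Longrightarrow> z \<in> K \<Longrightarrow> ad y (ad x A) z = 0"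
    using 0 by auto
  \<comment> \<open>The vanishing double commutators say that \<open>ad x A\<close> is
    \<open>K\<close>-linear.\<close>
  have val: "ad x A z = z * ad x A 1" if "x \<in> K" "z \<in> K" for x z
    using zero[OF that one_mem] by (simp add: twist_def)
  have "complex_derivation (\<lambda>x. ad x A 1)"
  proof -
    have "ad (x * y) A 1 = ad x A 1 * y + x * ad y A 1" if "x \<in> K" "y \<in> K" for x y
    proof -
      \<comment> \<open>In general \<open>ad (x * y) A 1\<close> equals
        \<open>ad x A y + x * ad y A 1\<close>; linearity turns this into the Leibniz rule.\<close>
      have "ad x A y = y * ad x A 1" using that by (rule val)
      then show ?thesis by (simp add: twist_def algebra_simps)
    qed
    then show ?thesis
      using add by (simp add: complex_derivation_def additive_on_def twist_def algebra_simps)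
  qed
  then have x1: "ad x A 1 = (\<Sum>t\<in>T. d t x * ad t A 1)" by (rule dual) (rule x)
  have "(\<Sum>t\<in>T. d t x * ad t A z) = z * (\<Sum>t\<in>T. d t x * ad t A 1)" if "z \<in> K" for z
    unfolding sum_distrib_left
  proof (rule sum.cong)
    fix t assume "t \<in> T"
    then have "ad t A z = z * ad t A 1" using T that val by blast
    then show "d t x * ad t A z = z * (d t x * ad t A 1)" by (simp only: mult.left_commute)
  qed simp
  then have "(\<Sum>t\<in>T. d t x * ad t A z) = z * ad x A 1" if "z \<in> K" for z
    unfolding x1 using that by blast
  moreover have "ad x A z = z * ad x A 1" if "z \<in> K" for z
    using x that by (rule val)
  ultimately show ?case unfolding order_less.simps by (metis diff_self)
next
  case (Suc k)
  have add: "additive_on K (\<lambda>y. ad x A y - (\<Sum>t\<in>T. d t x * ad t A y))"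
    using Suc.prems T x
    by (intro order_less_additive[of "Suc (Suc k)"] order_less_diff order_less_sum order_less_scale
        order_less_ad) auto
  \<comment> \<open>As \<open>ad z\<close> commutes with the other commutators, it turns the
    expression for \<open>A\<close> into the same one for \<open>ad z A\<close>.\<close>
  have "order_less K k (ad z (\<lambda>y. ad x A y - (\<Sum>t\<in>T. d t x * ad t A y)))" if "z \<in> K" for z
  proof (rule order_less_cong[OF Suc.IH[OF order_less_ad[OF Suc.prems that]]])
    fix y assume "y \<in> K"
    have "ad z (\<lambda>y. ad x A y - (\<Sum>t\<in>T. d t x * ad t A y)) y =
        ad z (ad x A) y - (\<Sum>t\<in>T. d t x * ad z (ad t A) y)"
      by (simp add: twist_def[of z] sum_distrib_left sum_subtractf sum.distrib sum_negf algebra_simps)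
    then show "ad z (\<lambda>y. ad x A y - (\<Sum>t\<in>T. d t x * ad t A y)) y =
        ad x (ad z A) y - (\<Sum>t\<in>T. d t x * ad t (ad z A) y)"
      by (simp add: twist_commute[of z])
  qed
  then show ?case using add by simp
qed

text \<open>Euler's identity for the symbol, which is homogeneous of degree \<open>N\<close>: the symbol of
  \<open>ad t A\<close> is the derivative of the symbol of \<open>A\<close> in the direction dual to \<open>d t\<close>.\<close>
lemma order_less_Euler:
  assumes dual: "\<And>D x. complex_derivation D \<Longrightarrow> x \<in> K \<Longrightarrow> D x = (\<Sum>t\<in>T. d t x * D t)"
    and T: "T \<subseteq> K" and d: "\<And>t. t \<in> T \<Longrightarrow> derivation_on K (d t)"
    and A: "order_less K (Suc N) A"
  shows "order_less K N (\<lambda>y. of_nat N * A y - (\<Sum>t\<in>T. ad t A (d t y)))"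
  using A
proof (induction N arbitrary: A)
  case 0
  have "d t y \<in> K" if "t \<in> T" "y \<in> K" for t y
    using d[OF that(1)] that(2) by (auto simp: derivation_on_def)
  then show ?case using 0 T by (auto intro!: sum.neutral)
next
  case (Suc N)
  let ?B = "\<lambda>y. of_nat (Suc N) * A y - (\<Sum>t\<in>T. ad t A (d t y))"
  have dK: "d t y \<in> K" if "t \<in> T" "y \<in> K" for t y
    using d[OF that(1)] that(2) by (auto simp: derivation_on_def)
  have adA: "order_less K (Suc N) (ad x A)" if "x \<in> K" for x
    using Suc.prems that by (rule order_less_ad)
  have add: "additive_on K ?B"
  proof -
    have "additive_on K A" using Suc.prems by simp
    moreover have "additive_on K (\<lambda>y. ad t A (d t y))" if "t \<in> T" for t
      using adA[of t] d[OF that] T that by (intro additive_on_comp_derivation[of "Suc N" "ad t A"]) auto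
    ultimately show ?thesis
      by (simp add: additive_on_def sum.distrib distrib_left)
  qed
  have "order_less K N (ad x ?B)" if x: "x \<in> K" for x
  proof -
    \<comment> \<open>The Leibniz rule for \<open>d t\<close> at \<open>x * y\<close> gives
      \<open>ad x ?B = ?E + ?L - ?R\<close>. Of the \<open>Suc N\<close> copies of
      \<open>ad x A\<close>, \<open>N\<close> enter the induction hypothesis \<open>?E\<close> and
      one enters the expansion \<open>?L\<close>; \<open>?R\<close> consists of double
      commutators.\<close>
    let ?E = "\<lambda>y. of_nat N * ad x A y - (\<Sum>t\<in>T. ad t (ad x A) (d t y))"
    let ?L = "\<lambda>y. ad x A y - (\<Sum>t\<in>T. d t x * ad t A y)"
    let ?R = "\<lambda>y. \<Sum>t\<in>T. ad (d t x) (ad t A) y"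
    have "order_less K N ?E" using Suc.IH[OF adA[OF x]] .
    moreover have "order_less K N ?L"
      using dual T Suc.prems x by (rule order_less_ad_expansion)
    moreover have "order_less K N ?R"
      using T dK x by (intro order_less_sum order_less_ad[OF adA]) auto
    ultimately have "order_less K N (\<lambda>y. ?E y + ?L y - ?R y)"
      by (rule order_less_diff[OF order_less_add])
    then show ?thesis
    proof (rule order_less_cong)
      fix y assume y: "y \<in> K"
      have "ad t A (d t (x * y)) - x * ad t A (d t y) =
          ad t (ad x A) (d t y) + d t x * ad t A y + ad (d t x) (ad t A) y" if t: "t \<in> T" for t
      proof -
        have "d t (x * y) = d t x * y + x * d t y"
          using d[OF t] x y by (simp add: derivation_on_def)
        moreover have "additive_on K (ad t A)"
          using adA[of t] t T order_less_additive by auto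
        ultimately have "ad t A (d t (x * y)) = ad t A (d t x * y) + ad t A (x * d t y)"
          using dK[OF t] x y by (simp add: additive_on_def mult_mem)
        then show ?thesis
          unfolding twist_commute[of t _ x] by (simp add: twist_def[of x] twist_def[of "d t x"])
      qed
      then have "(\<Sum>t\<in>T. ad t A (d t (x * y)) - x * ad t A (d t y)) =
          (\<Sum>t\<in>T. ad t (ad x A) (d t y)) + (\<Sum>t\<in>T. d t x * ad t A y) + ?R y"
        by (simp add: sum.distrib)
      moreover have "ad x ?B y = of_nat (Suc N) * ad x A y -
          (\<Sum>t\<in>T. ad t A (d t (x * y)) - x * ad t A (d t y))"
        by (simp add: twist_def[of x] sum_subtractf sum_distrib_left sum_negf algebra_simps)
      ultimately show "ad x ?B y = ?E y + ?L y - ?R y"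
        by (simp add: algebra_simps)
    qed
  qed
  then show ?case using add by simp
qed

text \<open>In Euler's identity both the remainder and each \<open>ad t A\<close> have smaller
  order, so induction applies to them; then divide by the order.\<close>

theorem order_less_imp_differential_operator:
  assumes "fin_gen_over_rat K" "order_less K N A"
  shows "differential_operator K A"
proof -
  obtain T d where T: "T \<subseteq> K" and d: "\<And>t. t \<in> T \<Longrightarrow> derivation_on K (d t)"
    and dual: "\<And>D x. complex_derivation D \<Longrightarrow> x \<in> K \<Longrightarrow> D x = (\<Sum>t\<in>T. d t x * D t)"
    using ex_dual_derivations[OF assms(1)] by blast
  show ?thesis using assms(2)
  proof (induction N arbitrary: A)
    case 0
    then show ?case by (intro differential_operator_cong[OF differential_operator_zero]) simp
  next
    case (Suc N)
    show ?case
    proof (cases N)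
      case 0
      \<comment> \<open>In order 0 the Euler factor is zero, so this case is direct:
        \<open>A\<close> is \<open>K\<close>-linear.\<close>
      have "A y = A 1 * y" if "y \<in> K" for y
      proof -
        have "ad y A 1 = 0" using Suc.prems 0 that by simp
        then show ?thesis by (simp add: twist_def mult.commute)
      qed
      then show ?thesis
        by (rule differential_operator_cong[OF differential_operator_scale[OF differential_operator_id]])
    next
      case (Suc m)
      then have nonzero: "of_nat N \<noteq> (0 :: complex)" by (simp del: of_nat_Suc)
      have "differential_operator K (\<lambda>y. of_nat N * A y - (\<Sum>t\<in>T. ad t A (d t y)))"
        using order_less_Euler[OF dual T d Suc.prems] by (rule Suc.IH)
      moreover have "differential_operator K (\<lambda>y. \<Sum>t\<in>T. ad t A (d t y))"
      proof (rule differential_operator_sum)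
        fix t assume t: "t \<in> T"
        have "differential_operator K (ad t A)" using Suc.prems T t by (intro Suc.IH) auto
        then show "differential_operator K (\<lambda>y. ad t A (d t y))"
          using d[OF t] by (rule differential_operator_comp_derivation)
      qed
      ultimately have "differential_operator K (\<lambda>y. inverse (of_nat N) *
          (of_nat N * A y - (\<Sum>t\<in>T. ad t A (d t y)) + (\<Sum>t\<in>T. ad t A (d t y))))"
        by (intro differential_operator_scale differential_operator_add)
      then show ?thesis
        by (rule differential_operator_cong) (simp add: left_inverse[OF nonzero] mult.assoc[symmetric])
    qed
  qed
qed


end

section \<open>Polynomial dependence on a rational parameter\<close>

text \<open>The shift \<open>x\<close> serves identities whose variable is \<open>x + r\<close>; for
  those in \<open>r\<close> itself it is 0.\<close>

lemma poly_eq_0_of_nat_roots: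
  fixes p :: "complex poly"
  assumes "\<And>r :: nat. poly p (x + of_nat r) = 0"
  shows "p = 0"
proof (rule ccontr)
  assume "p \<noteq> 0"
  then have "finite {z. poly p z = 0}" by (rule poly_roots_finite)
  moreover have "range (\<lambda>r :: nat. x + of_nat r) \<subseteq> {z. poly p z = 0}" using assms by auto
  moreover have "inj (\<lambda>r :: nat. x + of_nat r)" by (auto simp: inj_def)
  ultimately show False using finite_subset finite_imageD infinite_UNIV_nat by blast
qed

text \<open>The operator \<open>twist u p + X * twist v q\<close> with polynomial parameter \<open>X\<close>.\<close>
definition pencil :: "complex \<Rightarrow> complex \<Rightarrow> complex \<Rightarrow> complex \<Rightarrow>
    (complex \<Rightarrow> complex poly) \<Rightarrow> complex \<Rightarrow> complex poly" where
  "pencil u p v q F = (\<lambda>c. F (u * c) + smult p (F c) + pCons 0 (F (v * c) + smult q (F c)))"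

lemma coeff_pencil_0:
  "coeff ((pencil u p v q ^^ m) (\<lambda>c. [:A c:]) c) 0 = (twist u p ^^ m) A c"
  by (induction m arbitrary: c) (simp_all add: pencil_def twist_def)

text \<open>The two twists commute, so the linear coefficient is that of a binomial power. For
  \<open>m = 0\<close> the truncated exponent is harmless, since the factor \<open>of_nat m\<close>
  vanishes.\<close>

lemma coeff_pencil_1:
  "coeff ((pencil u p v q ^^ m) (\<lambda>c. [:A c:]) c) 1 =
     of_nat m * twist v q ((twist u p ^^ (m - 1)) A) c"
proof (induction m arbitrary: c)
  case (Suc m)
  let ?F = "(pencil u p v q ^^ m) (\<lambda>c. [:A c:])"
  define B where "B = twist v q ((twist u p ^^ (m - 1)) A)"
  have "coeff ((pencil u p v q ^^ Suc m) (\<lambda>c. [:A c:]) c) 1 =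
      coeff (?F (u * c)) 1 + p * coeff (?F c) 1 + (coeff (?F (v * c)) 0 + q * coeff (?F c) 0)"
    by (simp add: pencil_def)
  also have "\<dots> = of_nat m * twist u p B c + twist v q ((twist u p ^^ m) A) c"
    unfolding Suc.IH coeff_pencil_0 B_def[symmetric]
    by (simp add: twist_def[of u p B] twist_def[of v q "(twist u p ^^ m) A"] algebra_simps)
  also have "of_nat m * twist u p B c = of_nat m * twist v q ((twist u p ^^ m) A) c"
    by (cases m) (simp_all add: B_def twist_commute[of u p])
  finally show ?case by (simp add: algebra_simps)
qed (simp add: coeff_pCons)

context complex_subfield
begin

text \<open>By additivity, translation by \<open>u + r * v\<close> is translation by
  \<open>u\<close> plus \<open>r\<close> times translation by \<open>v\<close>, so at
  \<open>X = r\<close> the pencil becomes a single twist.\<close>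

lemma poly_pencil:
  assumes A: "additive_on K A" and uv: "u \<in> K" "v \<in> K" and c: "c \<in> K"
  shows "poly ((pencil u p v q ^^ m) (\<lambda>c. [:A c:]) c) (of_nat r) =
    (twist (u + of_nat r * v) (p + of_nat r * q) ^^ m) A c"
  using c
proof (induction m arbitrary: c)
  case (Suc m)
  define u' where "u' = u + of_nat r * v"
  define p' where "p' = p + of_nat r * q"
  define B where "B = (twist u' p' ^^ m) A"
  define F where "F = (pencil u p v q ^^ m) (\<lambda>c. [:A c:])"
  have IH: "poly (F y) (of_nat r) = B y" if "y \<in> K" for y
    using Suc.IH[OF that] by (simp only: B_def F_def u'_def p'_def)
  have B: "additive_on K B"
    unfolding B_def u'_def using A uv by (intro additive_on_funpow_twist mem_intros) auto
  have "B (u' * c) = B (u * c) + of_nat r * B (v * c)"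
    using B uv Suc.prems additive_of_nat_mult[OF B, of "v * c" r]
    by (simp add: additive_on_def mult_mem u'_def distrib_right mult.assoc)
  moreover have "(twist u' p' ^^ Suc m) A c = B (u' * c) + p' * B c"
    by (simp add: twist_def B_def)
  moreover have "(pencil u p v q ^^ Suc m) (\<lambda>c. [:A c:]) c = pencil u p v q F c"
    by (simp add: F_def)
  moreover have "poly (pencil u p v q F c) (of_nat r) =
      B (u * c) + of_nat r * B (v * c) + p' * B c"
    using Suc.prems uv by (simp add: pencil_def IH mult_mem p'_def algebra_simps)
  ultimately show ?case by (simp only: u'_def p'_def)
qed simp

text \<open>The coefficient linear in \<open>r\<close> of
  \<open>(ad (x + r * y) ^^ Suc N) A c = 0\<close> is \<open>Suc N\<close> times
  \<open>ad y ((ad x ^^ N) A) c\<close>. Hence \<open>ad y A\<close> satisfies the hypothesis for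
  \<open>N\<close>.\<close>

lemma iterated_ad_imp_order_less:
  assumes "additive_on K A" "\<And>x c. x \<in> K \<Longrightarrow> c \<in> K \<Longrightarrow> (ad x ^^ N) A c = 0"
  shows "order_less K N A"
  using assms
proof (induction N arbitrary: A)
  case 0
  then show ?case using 0(2)[of 1] by simp
next
  case (Suc N)
  have "order_less K N (ad y A)" if y: "y \<in> K" for y
  proof (rule Suc.IH)
    show "additive_on K (ad y A)" using Suc.prems(1) y by (rule additive_on_twist)
    fix x c assume xc: "x \<in> K" "c \<in> K"
    let ?p = "(pencil x (- x) y (- y) ^^ Suc N) (\<lambda>c. [:A c:]) c"
    have "poly ?p (0 + of_nat r) = 0" for r
    proof -
      have "poly ?p (of_nat r) = (twist (x + of_nat r * y) (- x + of_nat r * - y) ^^ Suc N) A c"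
        using Suc.prems(1) xc(1) y xc(2) by (rule poly_pencil)
      moreover have "- x + of_nat r * - y = - (x + of_nat r * y)" by simp
      ultimately have "poly ?p (of_nat r) = (ad (x + of_nat r * y) ^^ Suc N) A c" by (simp only:)
      also have "\<dots> = 0" using xc y by (intro Suc.prems(2) mem_intros) auto
      finally show ?thesis by (simp only: add_0)
    qed
    then have "?p = 0" by (rule poly_eq_0_of_nat_roots)
    then have "of_nat (Suc N) * ad y ((ad x ^^ N) A) c = 0"
      using coeff_pencil_1[where u = x and p = "- x" and v = y and q = "- y" and m = "Suc N" and A = A and c = c] by simp
    then show "(ad x ^^ N) (ad y A) c = 0"
      unfolding funpow_twist_commute by (simp only: mult_eq_0_iff of_nat_eq_0_iff) simp
  qed
  then show ?case using Suc.prems(1) by simp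
qed

text \<open>At \<open>X = x + r\<close> the operator \<open>ad x + X\<close> is translation by
  \<open>x + r\<close>. Thus \<open>A (z ^ m * c)\<close> with \<open>z = x + r\<close> is
  polynomial in \<open>z\<close>, with coefficients built from powers of
  \<open>ad x\<close>.\<close>

lemma poly_pencil_ad:
  assumes A: "additive_on K A" and x: "x \<in> K" and c: "c \<in> K"
  shows "poly ((pencil x (- x) 1 0 ^^ m) (\<lambda>c. [:A c:]) c) (x + of_nat r) =
    A ((x + of_nat r) ^ m * c)"
  using c
proof (induction m arbitrary: c)
  case (Suc m)
  let ?z = "x + of_nat r"
  have zm: "?z ^ m \<in> K" using x by (intro mem_intros) auto
  have "A (?z ^ m * (x * c) + of_nat r * (?z ^ m * c)) = A (?z ^ m * (x * c)) + of_nat r * A (?z ^ m * c)"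
    using A x zm Suc.prems additive_of_nat_mult[OF A, of "?z ^ m * c" r]
    by (simp add: additive_on_def mult_mem)
  then show ?case using Suc x
    by (simp add: pencil_def mult_mem algebra_simps)
qed simp

section \<open>From the functional equations to vanishing iterated commutators\<close>

definition polarized_solution :: "nat \<Rightarrow> (nat \<Rightarrow> complex) \<Rightarrow> (complex \<Rightarrow> complex) \<Rightarrow> bool" where
  "polarized_solution n a A \<longleftrightarrow> additive_on K A \<and>
     (\<forall>x\<in>K. \<forall>c\<in>units_of_field K.
        (\<Sum>i=0..n. of_nat (n+1-i) * a (n+1-i) *
           (x^i * A (c * x^(n+1-i)) - x^(i+1) * A (c * x^(n-i)))) = 0)"

text \<open>The equation at \<open>x + r\<close> is a polynomial identity in \<open>X = x + r\<close>, because
  \<open>ad (x + r) = ad x\<close>. Its coefficient at \<open>X ^ (n + 1 - N)\<close> is \<open>N * a N * (ad x ^^ N) A c\<close>.\<close>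
lemma polarized_solution_iterated_ad:
  assumes A: "polarized_solution n a A" and N: "N \<in> {1..n+1}" "a N \<noteq> 0"
    and max: "\<And>j. j \<in> {1..n+1} \<Longrightarrow> N < j \<Longrightarrow> a j = 0"
    and x: "x \<in> K" and c: "c \<in> K"
  shows "(ad x ^^ N) A c = 0"
proof -
  have add: "additive_on K A" using A by (simp add: polarized_solution_def)
  define w where "w m = (pencil x (- x) 1 0 ^^ m) (\<lambda>c. [:A c:]) c" for m
  define P where "P = (\<Sum>i=0..n. monom (of_nat (n+1-i) * a (n+1-i)) i * (w (n+1-i) - monom 1 1 * w (n-i)))"
  have "poly P (x + of_nat r) = 0" for r
  proof -
    let ?z = "x + of_nat r"
    have w: "poly (w m) ?z = A (c * ?z ^ m)" for m
      unfolding w_def poly_pencil_ad[OF add x c] by (simp add: mult.commute)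
    have "poly P ?z = (\<Sum>i=0..n. of_nat (n+1-i) * a (n+1-i) *
       (?z^i * A (c * ?z^(n+1-i)) - ?z^(i+1) * A (c * ?z^(n-i))))"
      unfolding P_def poly_sum
      by (intro sum.cong refl) (simp add: w poly_monom algebra_simps)
    also have "\<dots> = 0"
    \<comment> \<open>The equation is given for nonzero \<open>c\<close> only; at 0 it follows from
      \<open>A 0 = 0\<close>.\<close>
    proof (cases "c = 0")
      case True
      then show ?thesis by (simp add: additive_zero[OF add])
    next
      case False
      have "?z \<in> K" using x by (intro mem_intros) auto
      then show ?thesis using A c False by (simp add: polarized_solution_def)
    qed
    finally show ?thesis .
  qed
  then have "P = 0" by (rule poly_eq_0_of_nat_roots)
  let ?i = "n + 1 - N"
  \<comment> \<open>For \<open>i < ?i\<close> the index \<open>n + 1 - i\<close> exceeds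
    \<open>N\<close>, so its coefficient is zero; for \<open>i > ?i\<close> the monomial has too
    high a degree. At \<open>i = ?i\<close> only the constant coefficient of \<open>w N\<close>
    remains.\<close>
  have coeff: "coeff (monom (of_nat (n+1-i) * a (n+1-i)) i * (w (n+1-i) - monom 1 1 * w (n-i))) ?i =
      (if i = ?i then of_nat N * a N * (ad x ^^ N) A c else 0)" if "i \<in> {0..n}" for i
  proof (cases "i < ?i")
    case True
    then have "a (n + 1 - i) = 0" using that by (intro max) auto
    then show ?thesis using True by simp
  next
    case False
    have "i = ?i" if "\<not> ?i < i" using that False by simp
    moreover have "coeff (w N) 0 = (ad x ^^ N) A c" unfolding w_def by (rule coeff_pencil_0)
    ultimately show ?thesis using N by (auto simp: coeff_monom_mult)
  qed
  have "coeff P ?i = (\<Sum>i=0..n. if i = ?i then of_nat N * a N * (ad x ^^ N) A c else 0)"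
    unfolding P_def coeff_sum by (intro sum.cong refl coeff)
  also have "\<dots> = of_nat N * a N * (ad x ^^ N) A c"
  proof -
    have "?i \<in> {0..n}" using N by auto
    then show ?thesis by (simp add: sum.delta)
  qed
  finally show ?thesis using \<open>P = 0\<close> N by auto
qed

lemma polarized_solution_imp_order_less:
  assumes "polarized_solution n a A" "\<exists>j\<in>{1..n+1}. a j \<noteq> 0"
  shows "\<exists>N. order_less K N A"
proof -
  define J where "J = {j \<in> {1..n+1}. a j \<noteq> 0}"
  have J: "finite J" "J \<noteq> {}" using assms(2) by (auto simp: J_def)
  obtain N where "N \<in> J" "\<And>j. j \<in> J \<Longrightarrow> j \<le> N" using Max_in[OF J] Max_ge[OF J(1)] by blast
  then have N: "N \<in> {1..n+1}" "a N \<noteq> 0" and max: "\<And>j. j \<in> {1..n+1} \<Longrightarrow> N < j \<Longrightarrow> a j = 0"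
    unfolding J_def by (blast, blast, metis (mono_tags, lifting) leD mem_Collect_eq)
  have "additive_on K A" using assms(1) by (simp add: polarized_solution_def)
  then have "order_less K N A"
    using polarized_solution_iterated_ad[OF assms(1) N max] by (intro iterated_ad_imp_order_less)
  then show ?thesis ..
qed

text \<open>The terms linear in \<open>y\<close> of the equation at \<open>x + r y\<close> vanish; subtract \<open>x\<close> times the resulting
  identity for \<open>y = c\<close> from that for \<open>y = c x\<close>.\<close>
lemma polarization:
  assumes A: "additive_on K A"
    and eq: "\<And>x. x \<in> K \<Longrightarrow> (\<Sum>i=0..n. a (n+1-i) * x^i * A (x^(n+1-i))) = 0"
  shows "polarized_solution n a A"
proof -
  have linear: "(\<Sum>i=0..n. a (n+1-i) * (of_nat (n+1-i) * x^i * A (x^(n-i) * y) +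
      of_nat i * x^(i-1) * y * A (x^(n+1-i)))) = 0" if x: "x \<in> K" and y: "y \<in> K" for x y
  proof -
    define w where "w m = (pencil x 0 y 0 ^^ m) (\<lambda>c. [:A c:]) 1" for m
    define P where "P = (\<Sum>i=0..n. smult (a (n+1-i)) ([:x, y:] ^ i * w (n+1-i)))"
    have "poly P (0 + of_nat r) = 0" for r
    proof -
      let ?z = "x + of_nat r * y"
      have "poly (w m) (of_nat r) = A (?z ^ m)" for m
        using poly_pencil[OF A x y one_mem, where p = 0 and q = 0 and m = m and r = r] by (simp add: w_def funpow_translation)
      then have "poly P (of_nat r) = (\<Sum>i=0..n. a (n+1-i) * ?z^i * A (?z^(n+1-i)))"
        by (simp add: P_def poly_sum mult.assoc)
      then show ?thesis using eq[of ?z] x y by (simp add: mem_intros)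
    qed
    then have "P = 0" by (rule poly_eq_0_of_nat_roots)
    have lin: "coeff ([:x, y:] ^ i) 0 = x ^ i" "coeff ([:x, y:] ^ i) 1 = of_nat i * x^(i-1) * y" for i
    proof -
      show c0: "coeff ([:x, y:] ^ i) 0 = x ^ i" for i by (simp add: coeff_0_power)
      show "coeff ([:x, y:] ^ i) 1 = of_nat i * x^(i-1) * y"
      proof (induction i)
        case (Suc i)
        then show ?case by (cases i) (simp_all add: c0 algebra_simps)
      qed (simp add: coeff_pCons)
    qed
    have "coeff (w m) 0 = A (x ^ m)" "coeff (w m) 1 = of_nat m * A (x^(m-1) * y)" for m
      unfolding w_def coeff_pencil_0 coeff_pencil_1 funpow_translation
      by (simp_all add: twist_def[of y] funpow_translation)
    then have "coeff P 1 = (\<Sum>i=0..n. a (n+1-i) * (of_nat (n+1-i) * x^i * A (x^(n-i) * y) +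
      of_nat i * x^(i-1) * y * A (x^(n+1-i))))"
      unfolding P_def coeff_sum
      by (intro sum.cong refl) (simp add: coeff_mult lin[simplified] algebra_simps)
    then show ?thesis using \<open>P = 0\<close> by simp
  qed
  have "(\<Sum>i=0..n. of_nat (n+1-i) * a (n+1-i) *
      (x^i * A (c * x^(n+1-i)) - x^(i+1) * A (c * x^(n-i)))) = 0" if x: "x \<in> K" and c: "c \<in> K" for x c
  proof -
    \<comment> \<open>The terms with factor \<open>of_nat i\<close> cancel in the
      difference.\<close>
    have "(\<Sum>i=0..n. of_nat (n+1-i) * a (n+1-i) *
        (x^i * A (c * x^(n+1-i)) - x^(i+1) * A (c * x^(n-i)))) =
      (\<Sum>i=0..n. a (n+1-i) * (of_nat (n+1-i) * x^i * A (x^(n-i) * (c * x)) +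
        of_nat i * x^(i-1) * (c * x) * A (x^(n+1-i)))) -
      x * (\<Sum>i=0..n. a (n+1-i) * (of_nat (n+1-i) * x^i * A (x^(n-i) * c) +
        of_nat i * x^(i-1) * c * A (x^(n+1-i))))"
      unfolding sum_distrib_left sum_subtractf[symmetric]
      by (intro sum.cong refl) (simp add: Suc_diff_le algebra_simps)
    then show ?thesis using linear[OF x mult_mem[OF c x]] linear[OF x c] by simp
  qed
  then show ?thesis using A by (simp add: polarized_solution_def)
qed


subsection \<open>The variety of solutions\<close>

text \<open>An additive function vanishes at 0, so this is the only candidate for an additive
  extension from the units to \<open>K\<close>. It replaces the existential in
  \<open>solution_space\<close> by conditions on the values of \<open>f\<close>, as closedness
  requires.\<close>

definition extend_zero :: "(complex \<Rightarrow> complex) \<Rightarrow> complex \<Rightarrow> complex" where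
  "extend_zero f y = (if y = 0 then 0 else f y)"

lemma polarized_solution_cong:
  assumes "polarized_solution n a A" and eq: "\<And>y. y \<in> K \<Longrightarrow> B y = A y"
  shows "polarized_solution n a B"
proof -
  have "(\<Sum>i=0..n. of_nat (n+1-i) * a (n+1-i) * (x^i * B (c * x^(n+1-i)) - x^(i+1) * B (c * x^(n-i)))) =
      (\<Sum>i=0..n. of_nat (n+1-i) * a (n+1-i) * (x^i * A (c * x^(n+1-i)) - x^(i+1) * A (c * x^(n-i))))"
    if "x \<in> K" "c \<in> units_of_field K" for x c
    using that by (intro sum.cong refl) (simp add: eq mult_mem power_mem del: power_Suc)
  then show ?thesis
    using assms(1) eq by (simp add: polarized_solution_def additive_on_def add_mem)
qed

lemma polarized_solution_zero: "polarized_solution n a (\<lambda>y. 0)"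
  by (simp add: polarized_solution_def additive_on_def)

lemma polarized_solution_add:
  assumes "polarized_solution n a A" "polarized_solution n a B"
  shows "polarized_solution n a (\<lambda>y. A y + B y)"
proof -
  have "(\<Sum>i=0..n. of_nat (n+1-i) * a (n+1-i) * (x^i * (A (c * x^(n+1-i)) + B (c * x^(n+1-i))) - x^(i+1) * (A (c * x^(n-i)) + B (c * x^(n-i))))) =
      (\<Sum>i=0..n. of_nat (n+1-i) * a (n+1-i) * (x^i * A (c * x^(n+1-i)) - x^(i+1) * A (c * x^(n-i)))) +
      (\<Sum>i=0..n. of_nat (n+1-i) * a (n+1-i) * (x^i * B (c * x^(n+1-i)) - x^(i+1) * B (c * x^(n-i))))"
    for x c
    unfolding sum.distrib[symmetric] by (intro sum.cong refl) (simp add: algebra_simps)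
  then show ?thesis using assms by (simp add: polarized_solution_def additive_on_def)
qed

lemma polarized_solution_scale:
  assumes "polarized_solution n a A"
  shows "polarized_solution n a (\<lambda>y. b * A y)"
proof -
  have "(\<Sum>i=0..n. of_nat (n+1-i) * a (n+1-i) * (x^i * (b * A (c * x^(n+1-i))) - x^(i+1) * (b * A (c * x^(n-i))))) =
      b * (\<Sum>i=0..n. of_nat (n+1-i) * a (n+1-i) * (x^i * A (c * x^(n+1-i)) - x^(i+1) * A (c * x^(n-i))))"
    for x c
    unfolding sum_distrib_left by (intro sum.cong refl) (simp add: algebra_simps)
  then show ?thesis using assms
    by (simp add: polarized_solution_def additive_on_def distrib_left)
qed

lemma polarized_solution_translate:
  assumes "polarized_solution n a A" "d \<in> units_of_field K"
  shows "polarized_solution n a (\<lambda>y. A (d * y))"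
  using assms by (auto simp: polarized_solution_def additive_on_def distrib_left mult_mem mult.assoc[symmetric])

definition solution_space :: "nat \<Rightarrow> (nat \<Rightarrow> complex) \<Rightarrow> (complex \<Rightarrow> complex) set" where
  "solution_space n a = {restrict A (units_of_field K) | A. polarized_solution n a A}"

lemma restrict_mem_solution_space:
  "polarized_solution n a A \<Longrightarrow> restrict A (units_of_field K) \<in> solution_space n a"
  by (auto simp: solution_space_def)

lemma mem_solution_space_iff:
  "f \<in> solution_space n a \<longleftrightarrow>
     f \<in> (units_of_field K \<rightarrow>\<^sub>E UNIV) \<and> polarized_solution n a (extend_zero f)"
proof
  assume "f \<in> solution_space n a"
  then obtain A where f: "f = restrict A (units_of_field K)" and A: "polarized_solution n a A"
    by (auto simp: solution_space_def)
  have "A 0 = 0" using A additive_zero by (simp add: polarized_solution_def)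
  then have "polarized_solution n a (extend_zero f)"
    by (intro polarized_solution_cong[OF A]) (simp add: extend_zero_def f)
  then show "f \<in> (units_of_field K \<rightarrow>\<^sub>E UNIV) \<and> polarized_solution n a (extend_zero f)"
    by (simp add: f)
next
  assume f: "f \<in> (units_of_field K \<rightarrow>\<^sub>E UNIV) \<and> polarized_solution n a (extend_zero f)"
  then have "f = restrict (extend_zero f) (units_of_field K)"
    by (auto simp: extend_zero_def restrict_def PiE_def extensional_def)
  then show "f \<in> solution_space n a" using f restrict_mem_solution_space by metis
qed

lemma linear_subspace_solution_space: "linear_subspace (units_of_field K) (solution_space n a)"
  unfolding linear_subspace_def
proof (intro conjI ballI allI)
  show "solution_space n a \<subseteq> (units_of_field K \<rightarrow>\<^sub>E UNIV)"
    by (auto simp: mem_solution_space_iff)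
  show "(\<lambda>x\<in>units_of_field K. 0) \<in> solution_space n a"
    by (rule restrict_mem_solution_space[OF polarized_solution_zero])
  fix f assume f: "f \<in> solution_space n a"
  then obtain A where A: "f = restrict A (units_of_field K)" "polarized_solution n a A"
    by (auto simp: solution_space_def)
  have "(\<lambda>x\<in>units_of_field K. b * f x) = (\<lambda>x\<in>units_of_field K. b * A x)" for b
    by (auto simp: A)
  then show "(\<lambda>x\<in>units_of_field K. b * f x) \<in> solution_space n a" for b
    using restrict_mem_solution_space[OF polarized_solution_scale[OF A(2)]] by metis
  fix g assume "g \<in> solution_space n a"
  then obtain B where B: "g = restrict B (units_of_field K)" "polarized_solution n a B"
    by (auto simp: solution_space_def)
  have "(\<lambda>x\<in>units_of_field K. f x + g x) = (\<lambda>x\<in>units_of_field K. A x + B x)"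
    by (auto simp: A B)
  then show "(\<lambda>x\<in>units_of_field K. f x + g x) \<in> solution_space n a"
    using restrict_mem_solution_space[OF polarized_solution_add[OF A(2) B(2)]] by metis
qed

lemma continuous_map_extend_zero:
  assumes "y \<in> K"
  shows "continuous_map (pointwise_topology (units_of_field K)) euclidean (\<lambda>f. extend_zero f y)"
proof (cases "y = 0")
  case False
  then show ?thesis
    using continuous_map_product_projection[of y "units_of_field K" "\<lambda>_. euclidean"] assms
    by (simp add: extend_zero_def)
qed (simp add: extend_zero_def)

lemma continuous_map_mult_const:
  fixes g :: "'a \<Rightarrow> complex"
  assumes "continuous_map X euclidean g"
  shows "continuous_map X euclidean (\<lambda>f. c * g f)"
proof -
  have "continuous_map euclidean euclidean (\<lambda>z :: complex. c * z)"
    by (simp add: continuous_on_mult_left)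
  then show ?thesis using continuous_map_compose[OF assms, of euclidean "(*) c"] by (simp add: o_def)
qed

lemma closedin_Collect_zero:
  fixes g :: "'a \<Rightarrow> complex"
  assumes "continuous_map X euclidean g"
  shows "closedin X {f \<in> topspace X. g f = 0}"
  using closedin_continuous_map_preimage[OF assms, of "{0}"] by simp

text \<open>Each instance of additivity or of the equation involves finitely many values of
  \<open>f\<close>, so it cuts out the zero set of a continuous map.\<close>

lemma closedin_solution_space:
  "closedin (pointwise_topology (units_of_field K)) (solution_space n a)"
proof -
  let ?X = "pointwise_topology (units_of_field K)"
  let ?g = "\<lambda>(x, y) f. extend_zero f (x + y) - (extend_zero f x + extend_zero f y)"
  let ?h = "\<lambda>(x, c) f. \<Sum>i=0..n. of_nat (n+1-i) * a (n+1-i) *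
    (x^i * extend_zero f (c * x^(n+1-i)) - x^(i+1) * extend_zero f (c * x^(n-i)))"
  have g: "closedin ?X {f \<in> topspace ?X. ?g p f = 0}" if "p \<in> K \<times> K" for p
    using that by (intro closedin_Collect_zero)
      (auto intro!: continuous_map_diff continuous_map_add continuous_map_extend_zero add_mem)
  have h: "closedin ?X {f \<in> topspace ?X. ?h p f = 0}" if "p \<in> K \<times> units_of_field K" for p
    using that by (intro closedin_Collect_zero)
      (auto intro!: continuous_map_sum continuous_map_mult_const continuous_map_diff
        continuous_map_extend_zero mem_intros simp del: power_Suc)
  have "solution_space n a = (\<Inter>p\<in>K \<times> K. {f \<in> topspace ?X. ?g p f = 0}) \<inter>
      (\<Inter>p\<in>K \<times> units_of_field K. {f \<in> topspace ?X. ?h p f = 0})"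
    (is "_ = ?R")
  proof (intro set_eqI iffI)
    fix f assume "f \<in> solution_space n a"
    then show "f \<in> ?R"
      by (auto simp: mem_solution_space_iff polarized_solution_def additive_on_def)
  next
    fix f assume f: "f \<in> ?R"
    have "f \<in> topspace ?X" using f zero_mem by blast
    moreover have "extend_zero f (x + y) = extend_zero f x + extend_zero f y" if "x \<in> K" "y \<in> K" for x y
    proof -
      have "?g (x, y) f = 0" using f that by blast
      then show ?thesis by simp
    qed
    moreover have "?h (x, c) f = 0" if "x \<in> K" "c \<in> units_of_field K" for x c
      using f that by blast
    ultimately show "f \<in> solution_space n a"
      unfolding mem_solution_space_iff polarized_solution_def additive_on_def by auto
  qed
  \<comment> \<open>\<open>closedin_INT\<close> asks for inhabited index sets; the pair
    \<open>(0, 1)\<close> lies in both.\<close>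
  moreover have nonempty: "K \<times> K \<noteq> {}" "K \<times> units_of_field K \<noteq> {}"
    by (rule ex_in_conv[THEN iffD1, OF exI[of _ "(0, 1)"]]; simp)+
  then have "closedin ?X ?R"
    by (intro closedin_Int[OF closedin_INT[OF nonempty(1) g] closedin_INT[OF nonempty(2) h]])
  ultimately show ?thesis by (simp only:)
qed

lemma variety_solution_space: "variety K (solution_space n a)"
  unfolding variety_def closed_linear_subspace_def
proof (intro conjI ballI linear_subspace_solution_space closedin_solution_space)
  fix f c assume "f \<in> solution_space n a" and c: "c \<in> units_of_field K"
  then obtain A where A: "f = restrict A (units_of_field K)" "polarized_solution n a A"
    by (auto simp: solution_space_def)
  have "(\<lambda>x\<in>units_of_field K. f (c * x)) = (\<lambda>x\<in>units_of_field K. A (c * x))"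
    using c by (auto simp: A mult_mem)
  then show "(\<lambda>x\<in>units_of_field K. f (c * x)) \<in> solution_space n a"
    using restrict_mem_solution_space[OF polarized_solution_translate[OF A(2) c]] by metis
qed

text \<open>An exponential in the variety satisfies \<open>(ad x ^^ N) m 1 = (m x - x) ^ N\<close>.\<close>
lemma exponential_solution_eq:
  assumes "\<exists>j\<in>{1..n+1}. a j \<noteq> 0" and m: "m \<in> solution_space n a" "exponential K m"
    and x: "x \<in> units_of_field K"
  shows "m x = x"
proof -
  obtain N where N: "order_less K N (extend_zero m)"
    using m polarized_solution_imp_order_less[OF _ assms(1)] mem_solution_space_iff by blast
  have mult: "m (y * z) = m y * m z" if "y \<in> units_of_field K" "z \<in> units_of_field K" for y z
    using m(2) that by (auto simp: exponential_def)
  obtain y where y: "y \<in> units_of_field K" "m y \<noteq> 0" using m(2) by (auto simp: exponential_def)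
  have "m 1 \<noteq> 0" using mult[of 1 y] y by auto
  \<comment> \<open>Downward induction from \<open>k = N\<close>: each \<open>ad x\<close> lowers
    the order and contributes a factor \<open>m x - x\<close>. At \<open>k = 0\<close> the function
    vanishes on \<open>K\<close>, in particular at 1.\<close>
  have "order_less K k (\<lambda>y. (m x - x) ^ (N - k) * extend_zero m y)" if "k \<le> N" for k
    using that
  proof (induction "N - k" arbitrary: k)
    case 0
    then show ?case using N by simp
  next
    case (Suc j)
    then have k: "Suc k \<le> N" "j = N - Suc k" by auto
    let ?B = "\<lambda>y. (m x - x) ^ (N - Suc k) * extend_zero m y"
    have "order_less K (Suc k) ?B" using Suc.hyps(1)[OF k(2,1)] .
    then have "order_less K k (ad x ?B)" using x by simp
    then show ?case
    proof (rule order_less_cong)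
      fix y assume "y \<in> K"
      have "extend_zero m (x * y) = m x * extend_zero m y"
        using mult[OF x, of y] \<open>y \<in> K\<close> x by (auto simp: extend_zero_def)
      moreover have "N - k = Suc (N - Suc k)" using k by simp
      ultimately show "(m x - x) ^ (N - k) * extend_zero m y = ad x ?B y"
        by (simp add: twist_def algebra_simps)
    qed
  qed
  from this[of 0] have "(m x - x) ^ N * m 1 = 0"
    by (simp add: extend_zero_def) (metis one_mem one_neq_zero)
  then show ?thesis using \<open>m 1 \<noteq> 0\<close> by simp
qed

end

section \<open>Assembly of the four claims\<close>

theorem mainTheorem8:
  fixes K :: "complex set" and n :: nat and a :: "nat \<Rightarrow> complex"
    and V :: "(complex \<Rightarrow> complex) set"
  assumes "is_subfield K"
    and "fin_gen_over_rat K"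
    and "\<exists>j\<in>{1..n+1}. a j \<noteq> 0"
    and V_eq: "V = {restrict A (units_of_field K) | A. additive_on K A \<and>
          (\<forall>x\<in>K. \<forall>c\<in>units_of_field K.
             (\<Sum>i=0..n. of_nat (n+1-i) * a (n+1-i) *
                (x^i * A (c * x^(n+1-i)) - x^(i+1) * A (c * x^(n-i)))) = 0)}"
  shows "(\<forall>A. additive_on K A \<and>
            (\<forall>x\<in>K. (\<Sum>i=0..n. a (n+1-i) * x^i * A (x^(n+1-i))) = 0) \<longrightarrow>
            restrict A (units_of_field K) \<in> V) \<and>
         variety K V \<and>
         (\<forall>m\<in>V. exponential K m \<longrightarrow> (\<forall>x\<in>units_of_field K. m x = x)) \<and>
         spanned_by_differential_operators K V"
proof -
  interpret complex_subfield K by standard (rule assms(1))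
  have V: "V = solution_space n a"
    unfolding V_eq solution_space_def polarized_solution_def ..
  have "\<exists>D. differential_operator K D \<and> f = restrict D (units_of_field K)" if f: "f \<in> V" for f
  proof -
    obtain A where A: "f = restrict A (units_of_field K)" "polarized_solution n a A"
      using f unfolding V solution_space_def by blast
    have "differential_operator K A"
      using polarized_solution_imp_order_less[OF A(2) assms(3)]
        order_less_imp_differential_operator[OF assms(2)] by blast
    then show ?thesis using A(1) by blast
  qed
  then have "{f \<in> V. \<exists>D. differential_operator K D \<and> f = restrict D (units_of_field K)} = V"
    by blast
  moreover have "closed_linear_subspace (units_of_field K) V"
    using variety_solution_space by (simp add: V variety_def)
  ultimately have "spanned_by_differential_operators K V"
    unfolding spanned_by_differential_operators_def by (simp add: hull_same)
  moreover have "restrict A (units_of_field K) \<in> V"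
    if "additive_on K A" "\<forall>x\<in>K. (\<Sum>i=0..n. a (n+1-i) * x^i * A (x^(n+1-i))) = 0" for A
    unfolding V using that by (intro restrict_mem_solution_space polarization) auto
  moreover have "m x = x" if "m \<in> V" "exponential K m" "x \<in> units_of_field K" for m x
    using exponential_solution_eq[OF assms(3)] that V by blast
  ultimately show ?thesis using variety_solution_space V by blast
qed

end
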